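(* Let $R$ be a ring, $n\ge 1$, and let $\varphi_{1,n}$, $\varphi_{n,1}$, $\varphi_{1,1}$ be additive isomorphisms of $M_{1,n}(R)=R^n$, $M_{n,1}(R)={}^nR$ and $M_{1,1}(R)=R$ onto themselves, respectively. Let $C\subseteq R^n$. With the notation of the context: (1) $C^{*\perp}=\bigl(\varphi_{n,1}\bigl((\varphi_{1,n}^{-1}(C))^{\perp}\bigr)\bigr)^t$; (2) $\varphi_{1,n}^{-1}({}^{\perp *}C)=\bigl(\varphi_{n,1}^{-1}(C^t)\bigr)^{\perp}$; (3) ${}^{\perp\circ}C=\varphi_{1,n}^{-1}\bigl((\varphi_{n,1}(C^t))^{\perp}\bigr)$; (4) $C^{\circ\perp}=\bigl(\varphi_{n,1}^{-1}\bigl((\varphi_{1,n}(C))^{\perp}\bigr)\bigr)^t$.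
   Context: Rings are associative with a unit element, not necessarily commutative. $R^n$ denotes rows $M_{1,n}(R)$ and ${}^nR$ denotes columns $M_{n,1}(R)$; $x^t$ is the transpose, and for a set $X$ of rows or columns $X^t=\{x^t: x\in X\}$. Two scalar products $R^n\times{}^nR\to R$ are defined, for $a,b\in R^n$, by $$a\circ b^t=\varphi_{1,1}^{-1}(\varphi_{1,n}(a)\varphi_{n,1}(b^t)),\qquad a*b^t=\varphi_{1,1}(\varphi_{1,n}^{-1}(a)\varphi_{n,1}^{-1}(b^t)).$$ For $C\subseteq R^n$: ${}^{\perp *}C=\{x\in R^n: x*c^t=0\ \forall c\in C\}$, $C^{*\perp}=\{x\in R^n: c*x^t=0\ \forall c\in C\}$, ${}^{\perp\circ}C=\{x\in R^n: x\circ c^t=0\ \forall c\in C\}$, $C^{\circ\perp}=\{x\in R^n: c\circ x^t=0\ \forall c\in C\}$. The symbol $\perp$ alone is the usual orthogonality between rows and columns: for $X\subseteq R^n$, $X^\perp=\{y\in{}^nR: xy=0\ \forall x\in X\}$, and for $Y\subseteq{}^nR$, $Y^\perp=\{x\in R^n: xy=0\ \forall y\in Y\}$, where $xy$ is the usual matrix product. *)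

theory Defs
  imports "Jordan_Normal_Form.Matrix"
begin

text \<open>
  Rows \<open>R\<^sup>n = M\<^sub>1\<^sub>,\<^sub>n(R)\<close> are \<^term>\<open>carrier_mat 1 n\<close>, columns are \<^term>\<open>carrier_mat n 1\<close>, and
  \<open>R\<close> itself is identified with \<open>M\<^sub>1\<^sub>,\<^sub>1(R)\<close>, i.e. \<^term>\<open>carrier_mat 1 1\<close>, so all scalar products are
  1-by-1 matrices and their vanishing is equality with \<^term>\<open>0\<^sub>m 1 1\<close>.
  Rings are types of sort \<open>{ring, monoid_mult}\<close>: associative and unital, and, unlike \<open>ring_1\<close>, not
  excluding the zero ring; the definitions themselves do not need the unit.
  The maps \<open>f1n\<close>, \<open>fn1\<close>, \<open>f11\<close> below stand for \<open>\<phi>\<^sub>1\<^sub>,\<^sub>n\<close>, \<open>\<phi>\<^sub>n\<^sub>,\<^sub>1\<close>, \<open>\<phi>\<^sub>1\<^sub>,\<^sub>1\<close>.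
\<close>

definition additive_iso :: "nat \<Rightarrow> nat \<Rightarrow> ('a::ring mat \<Rightarrow> 'a mat) \<Rightarrow> bool" where
  "additive_iso p q f \<longleftrightarrow> f \<in> iso (monoid_mat TYPE('a) p q) (monoid_mat TYPE('a) p q)"

text \<open>HOL functions are total on \<^typ>\<open>'a mat\<close>, so \<open>f\<close> is inverted on the matrices of size
  \<open>p \<times> q\<close> only; outside that set \<open>inv_mat p q f\<close> is unspecified.\<close>

abbreviation inv_mat :: "nat \<Rightarrow> nat \<Rightarrow> ('a mat \<Rightarrow> 'a mat) \<Rightarrow> 'a mat \<Rightarrow> 'a mat" where
  "inv_mat p q f \<equiv> inv_into (carrier_mat p q) f"

definition circ_prod ::
  "('a::ring mat \<Rightarrow> 'a mat) \<Rightarrow> ('a mat \<Rightarrow> 'a mat) \<Rightarrow> ('a mat \<Rightarrow> 'a mat)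
    \<Rightarrow> 'a mat \<Rightarrow> 'a mat \<Rightarrow> 'a mat" where
  "circ_prod f1n fn1 f11 a y = inv_mat 1 1 f11 (f1n a * fn1 y)"

definition star_prod ::
  "nat \<Rightarrow> ('a::ring mat \<Rightarrow> 'a mat) \<Rightarrow> ('a mat \<Rightarrow> 'a mat) \<Rightarrow> ('a mat \<Rightarrow> 'a mat)
    \<Rightarrow> 'a mat \<Rightarrow> 'a mat \<Rightarrow> 'a mat" where
  "star_prod n f1n fn1 f11 a y = f11 (inv_mat 1 n f1n a * inv_mat n 1 fn1 y)"

text \<open>For a product \<open>pr\<close> of rows with columns and a set \<open>C\<close> of rows, the left and right
  orthogonals of \<open>C\<close> are again sets of rows.\<close>

definition left_perp ::
  "nat \<Rightarrow> ('a::ring mat \<Rightarrow> 'a mat \<Rightarrow> 'a mat) \<Rightarrow> 'a mat set \<Rightarrow> 'a mat set" where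
  "left_perp n pr C = {x \<in> carrier_mat 1 n. \<forall>c\<in>C. pr x (transpose_mat c) = 0\<^sub>m 1 1}"

definition right_perp ::
  "nat \<Rightarrow> ('a::ring mat \<Rightarrow> 'a mat \<Rightarrow> 'a mat) \<Rightarrow> 'a mat set \<Rightarrow> 'a mat set" where
  "right_perp n pr C = {x \<in> carrier_mat 1 n. \<forall>c\<in>C. pr c (transpose_mat x) = 0\<^sub>m 1 1}"

text \<open>The usual orthogonality \<open>\<bottom>\<close> for \<open>x * y\<close> (row times column) is split in two, since the type does not
  tell rows from columns.\<close>

definition perp_of_rows :: "nat \<Rightarrow> 'a::ring mat set \<Rightarrow> 'a mat set" where
  "perp_of_rows n X = {y \<in> carrier_mat n 1. \<forall>x\<in>X. x * y = 0\<^sub>m 1 1}"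

definition perp_of_cols :: "nat \<Rightarrow> 'a::ring mat set \<Rightarrow> 'a mat set" where
  "perp_of_cols n Y = {x \<in> carrier_mat 1 n. \<forall>y\<in>Y. x * y = 0\<^sub>m 1 1}"

end

theory Submission
  imports Defs
begin

text \<open>
  Both scalar products arise from the matrix product by a change of variables: up to an additive
  bijection \<open>h\<close> of \<open>R\<close> applied at the end, they have the form \<open>h (g a * k y)\<close> with bijections \<open>g\<close>
  of the rows and \<open>k\<close> of the columns. An additive bijection \<open>h\<close> vanishes exactly
  at \<open>0\<close>, so \<open>a\<close> and \<open>y\<close> are orthogonal for the new product exactly when \<open>g a\<close> and \<open>k y\<close> are
  orthogonal in the usual sense. Hence \<open>g\<close> carries left orthogonals, and \<open>k\<close> (after transposition)
  right orthogonals, onto usual ones: this is \<open>image_left_perp\<close> and \<open>image_transpose_right_perp\<close>.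
  For \<open>*\<close> one takes \<open>g = \<phi>\<^sub>1\<^sub>,\<^sub>n\<^sup>-\<^sup>1\<close>, \<open>k = \<phi>\<^sub>n\<^sub>,\<^sub>1\<^sup>-\<^sup>1\<close>, \<open>h = \<phi>\<^sub>1\<^sub>,\<^sub>1\<close>, for \<open>\<circ>\<close> the inverse maps; since the
  inverse of an additive isomorphism is again one, both cases are symmetric. The
  four formulas follow by undoing \<open>g\<close>, \<open>k\<close> and the transposition where necessary.
\<close>

lemma additive_iso_bij_betw:
  assumes "additive_iso p q f"
  shows "bij_betw f (carrier_mat p q) (carrier_mat p q)"
  using assms by (auto simp: additive_iso_def iso_def monoid_mat_def)

lemma additive_iso_inv_mat:
  fixes f :: "'a::ring mat \<Rightarrow> 'a mat"
  assumes "additive_iso p q f"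
  shows "additive_iso p q (inv_mat p q f)"
proof -
  interpret comm_group "monoid_mat TYPE('a) p q" by (rule comm_group_mat)
  show ?thesis
    using assms iso_set_sym[of f "monoid_mat TYPE('a) p q"]
    by (simp add: additive_iso_def) (simp add: monoid_mat_def)
qed

lemma additive_iso_eq_zero_iff:
  fixes f :: "'a::ring mat \<Rightarrow> 'a mat"
  assumes f: "additive_iso p q f" and A: "A \<in> carrier_mat p q"
  shows "f A = 0\<^sub>m p q \<longleftrightarrow> A = 0\<^sub>m p q"
proof -
  interpret comm_group "monoid_mat TYPE('a) p q" by (rule comm_group_mat)
  have "f \<in> hom (monoid_mat TYPE('a) p q) (monoid_mat TYPE('a) p q)"
    using f by (simp add: additive_iso_def iso_def)
  from hom_one[OF this is_group is_group] have "f (0\<^sub>m p q) = 0\<^sub>m p q"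
    by (simp add: monoid_mat_def)
  then show ?thesis
    using additive_iso_bij_betw[OF f] A by (metis bij_betw_def inj_on_def zero_carrier_mat)
qed

text \<open>Surjectivity of \<open>g\<close> is what makes the image all of the usual orthogonal: every row
  orthogonal to the transformed columns is some \<open>g x\<close>, and that \<open>x\<close> is orthogonal to \<open>C\<close>.\<close>

lemma image_left_perp:
  fixes g k :: "'a::ring mat \<Rightarrow> 'a mat"
  assumes "g ` carrier_mat 1 n = carrier_mat 1 n"
    and "C \<subseteq> carrier_mat 1 n"
    and "\<And>a y. a \<in> carrier_mat 1 n \<Longrightarrow> y \<in> carrier_mat n 1 \<Longrightarrow>
           pr a y = 0\<^sub>m 1 1 \<longleftrightarrow> g a * k y = 0\<^sub>m 1 1"
  shows "g ` left_perp n pr C = perp_of_cols n (k ` (transpose_mat ` C))"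
proof -
  have "left_perp n pr C = {x \<in> carrier_mat 1 n. g x \<in> perp_of_cols n (k ` (transpose_mat ` C))}"
    unfolding left_perp_def perp_of_cols_def
  proof (intro Collect_cong conj_cong refl)
    fix x :: "'a mat"
    assume x: "x \<in> carrier_mat 1 n"
    then have "g x \<in> carrier_mat 1 n" using assms(1) by blast
    moreover have "pr x (transpose_mat c) = 0\<^sub>m 1 1 \<longleftrightarrow> g x * k (transpose_mat c) = 0\<^sub>m 1 1"
      if "c \<in> C" for c
      using that x assms(2) by (intro assms(3)) auto
    ultimately show "(\<forall>c\<in>C. pr x (transpose_mat c) = 0\<^sub>m 1 1) \<longleftrightarrow>
        g x \<in> {x \<in> carrier_mat 1 n. \<forall>y\<in>k ` (transpose_mat ` C). x * y = 0\<^sub>m 1 1}"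
      by simp
  qed
  moreover have "perp_of_cols n (k ` (transpose_mat ` C)) \<subseteq> g ` carrier_mat 1 n"
    using assms(1) by (auto simp: perp_of_cols_def)
  ultimately show ?thesis by blast
qed

lemma transpose_mat_image_carrier: "transpose_mat ` carrier_mat p q = carrier_mat q p"
proof
  show "carrier_mat q p \<subseteq> transpose_mat ` carrier_mat p q"
    by (metis image_eqI subsetI transpose_carrier_mat transpose_transpose)
qed auto

lemma image_transpose_right_perp:
  fixes g k :: "'a::ring mat \<Rightarrow> 'a mat"
  assumes "k ` carrier_mat n 1 = carrier_mat n 1"
    and "C \<subseteq> carrier_mat 1 n"
    and "\<And>a y. a \<in> carrier_mat 1 n \<Longrightarrow> y \<in> carrier_mat n 1 \<Longrightarrow>
           pr a y = 0\<^sub>m 1 1 \<longleftrightarrow> g a * k y = 0\<^sub>m 1 1"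
  shows "k ` (transpose_mat ` right_perp n pr C) = perp_of_rows n (g ` C)"
proof -
  have "right_perp n pr C =
      {x \<in> carrier_mat 1 n. k (transpose_mat x) \<in> perp_of_rows n (g ` C)}"
    unfolding right_perp_def perp_of_rows_def
  proof (intro Collect_cong conj_cong refl)
    fix x :: "'a mat"
    assume "x \<in> carrier_mat 1 n"
    then have x: "transpose_mat x \<in> carrier_mat n 1" by simp
    then have "k (transpose_mat x) \<in> carrier_mat n 1" using assms(1) by blast
    moreover have "pr c (transpose_mat x) = 0\<^sub>m 1 1 \<longleftrightarrow> g c * k (transpose_mat x) = 0\<^sub>m 1 1"
      if "c \<in> C" for c
      using that x assms(2) by (intro assms(3)) auto
    ultimately show "(\<forall>c\<in>C. pr c (transpose_mat x) = 0\<^sub>m 1 1) \<longleftrightarrow>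
        k (transpose_mat x) \<in> {y \<in> carrier_mat n 1. \<forall>x\<in>g ` C. x * y = 0\<^sub>m 1 1}"
      by simp
  qed
  moreover have "perp_of_rows n (g ` C) \<subseteq> k ` (transpose_mat ` carrier_mat 1 n)"
    using assms(1) by (auto simp: perp_of_rows_def transpose_mat_image_carrier)
  ultimately show ?thesis by blast
qed

lemma star_prod_eq_zero_iff:
  assumes "additive_iso 1 n f1n" "additive_iso n 1 fn1" "additive_iso 1 1 f11"
    and "a \<in> carrier_mat 1 n" "y \<in> carrier_mat n 1"
  shows "star_prod n f1n fn1 f11 a y = 0\<^sub>m 1 1 \<longleftrightarrow>
    inv_mat 1 n f1n a * inv_mat n 1 fn1 y = 0\<^sub>m 1 1"
  unfolding star_prod_def
proof (rule additive_iso_eq_zero_iff[OF assms(3)])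
  show "inv_mat 1 n f1n a * inv_mat n 1 fn1 y \<in> carrier_mat 1 1"
    using assms(4,5) assms(1,2)[THEN additive_iso_inv_mat, THEN additive_iso_bij_betw, THEN bij_betwE]
    by (intro mult_carrier_mat) auto
qed

lemma circ_prod_eq_zero_iff:
  assumes "additive_iso 1 n f1n" "additive_iso n 1 fn1" "additive_iso 1 1 f11"
    and "a \<in> carrier_mat 1 n" "y \<in> carrier_mat n 1"
  shows "circ_prod f1n fn1 f11 a y = 0\<^sub>m 1 1 \<longleftrightarrow> f1n a * fn1 y = 0\<^sub>m 1 1"
  unfolding circ_prod_def
proof (rule additive_iso_eq_zero_iff[OF additive_iso_inv_mat[OF assms(3)]])
  show "f1n a * fn1 y \<in> carrier_mat 1 1"
    using assms(4,5) assms(1,2)[THEN additive_iso_bij_betw, THEN bij_betwE]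
    by (intro mult_carrier_mat) auto
qed

theorem proposition2p10:
  fixes n :: nat
    and f1n fn1 f11 :: "'a::{ring, monoid_mult} mat \<Rightarrow> 'a mat"
    and C :: "'a mat set"
  assumes "n \<ge> 1"
    and "additive_iso 1 n f1n"
    and "additive_iso n 1 fn1"
    and "additive_iso 1 1 f11"
    and "C \<subseteq> carrier_mat 1 n"
  shows "(right_perp n (star_prod n f1n fn1 f11) C
           = transpose_mat ` (fn1 ` perp_of_rows n (inv_mat 1 n f1n ` C)))
       \<and> (inv_mat 1 n f1n ` left_perp n (star_prod n f1n fn1 f11) C
           = perp_of_cols n (inv_mat n 1 fn1 ` (transpose_mat ` C)))
       \<and> (left_perp n (circ_prod f1n fn1 f11) C
           = inv_mat 1 n f1n ` perp_of_cols n (fn1 ` (transpose_mat ` C)))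
       \<and> (right_perp n (circ_prod f1n fn1 f11) C
           = transpose_mat ` (inv_mat n 1 fn1 ` perp_of_rows n (f1n ` C)))"
proof -
  note f = \<open>additive_iso 1 n f1n\<close> \<open>additive_iso n 1 fn1\<close> \<open>additive_iso 1 1 f11\<close>
  note C = \<open>C \<subseteq> carrier_mat 1 n\<close>
  note bij = f(1,2)[THEN additive_iso_bij_betw]
  note bij_inv = f(1,2)[THEN additive_iso_inv_mat, THEN additive_iso_bij_betw]
  note inj = bij[THEN bij_betw_imp_inj_on]
  note surj = bij[THEN bij_betw_imp_surj_on] bij_inv[THEN bij_betw_imp_surj_on]
  have left_rows: "left_perp n pr C \<subseteq> carrier_mat 1 n" for pr
    by (auto simp: left_perp_def)
  have right_cols: "transpose_mat ` right_perp n pr C \<subseteq> carrier_mat n 1" for pr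
    by (auto simp: right_perp_def)
  have transpose_cancel: "transpose_mat ` (transpose_mat ` X) = X" for X :: "'a mat set"
    by (simp add: image_image)
  have star_left: "inv_mat 1 n f1n ` left_perp n (star_prod n f1n fn1 f11) C
      = perp_of_cols n (inv_mat n 1 fn1 ` (transpose_mat ` C))"
    by (rule image_left_perp[OF surj(3) C]) (rule star_prod_eq_zero_iff[OF f])
  have star_right: "inv_mat n 1 fn1 ` (transpose_mat ` right_perp n (star_prod n f1n fn1 f11) C)
      = perp_of_rows n (inv_mat 1 n f1n ` C)"
    by (rule image_transpose_right_perp[OF surj(4) C]) (rule star_prod_eq_zero_iff[OF f])
  have circ_left: "f1n ` left_perp n (circ_prod f1n fn1 f11) C
      = perp_of_cols n (fn1 ` (transpose_mat ` C))"
    by (rule image_left_perp[OF surj(1) C]) (rule circ_prod_eq_zero_iff[OF f])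
  have circ_right: "fn1 ` (transpose_mat ` right_perp n (circ_prod f1n fn1 f11) C)
      = perp_of_rows n (f1n ` C)"
    by (rule image_transpose_right_perp[OF surj(2) C]) (rule circ_prod_eq_zero_iff[OF f])
  have "fn1 ` perp_of_rows n (inv_mat 1 n f1n ` C)
      = transpose_mat ` right_perp n (star_prod n f1n fn1 f11) C"
    unfolding star_right[symmetric] by (rule image_inv_into_cancel[OF surj(2) right_cols])
  moreover have "inv_mat 1 n f1n ` perp_of_cols n (fn1 ` (transpose_mat ` C))
      = left_perp n (circ_prod f1n fn1 f11) C"
    unfolding circ_left[symmetric] by (rule inv_into_image_cancel[OF inj(1) left_rows])
  moreover have "inv_mat n 1 fn1 ` perp_of_rows n (f1n ` C)
      = transpose_mat ` right_perp n (circ_prod f1n fn1 f11) C"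
    unfolding circ_right[symmetric] by (rule inv_into_image_cancel[OF inj(2) right_cols])
  ultimately show ?thesis by (simp only: star_left transpose_cancel simp_thms)
qed

end
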